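(* For every integer $n\ge 1$, $$g(n)\;\ge\;\left\lceil \log_3\!\left(2^n+2^{n-5}+2^{n-6}+2^{n-7}+2^{n-13}+2^{n-14}+2^{n-16}+2^{n-17}\right)\right\rceil,$$ where $g(n)$ is the least number of weighings needed to find all counterfeit coins among $n$ coins when the number of counterfeits is unknown, and powers of $2$ with negative exponents are interpreted as rational numbers.
   Context: Counterfeit coins problem with unknown number of fakes. Let $\mathcal S$ be a set of $n$ distinguishable (numbered) coins of the same appearance. An unknown subset $X\subseteq\mathcal S$ (any of the $2^n$ subsets, including $\emptyset$ and $\mathcal S$, is possible) consists of counterfeit coins. All genuine coins have one common weight, and all counterfeit coins have one common weight, known to be heavier than the genuine one (the case "lighter" is symmetric). A supply of additional coins known to be genuine is available. A weighing is a comparison $L:R$ on a two-pan balance, where $L,R\subseteq\mathcal S$ are disjoint sets of coins placed on the left and right pan; additional genuine coins are added, if needed, so that both pans hold the same number of coins. The outcome is one of the three symbols $<,=,>$: it is $<$, $=$ or $>$ according to whether $|X\cap L|<|X\cap R|$, $|X\cap L|=|X\cap R|$ or $|X\cap L|>|X\cap R|$. A strategy is adaptive: each weighing may depend on the outcomes of the preceding ones (i.e. it is a ternary decision tree whose internal nodes are labelled by weighings and whose edges are labelled by outcomes). A strategy finds all the fakes if distinct subsets $X\subseteq\mathcal S$ always lead to distinct sequences of outcomes, so that $X$ is determined by the outcomes. $g(n)$ denotes the least integer $k$ such that there is a strategy using at most $k$ weighings for every $X$ which finds all the fakes in $\mathcal S$. *)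

theory Defs
  imports Complex_Main
begin

datatype outcome = Lt | Eq | Gt

text \<open>
  The set \<open>X\<close> consists of the counterfeit (heavier) coins. Both pans are filled up to the same
  number of coins with additional genuine ones, so \<open>L\<close> and \<open>R\<close> may have different sizes and only
  the numbers of counterfeit coins on the two pans matter.
\<close>

definition weigh :: "'a set \<Rightarrow> 'a set \<Rightarrow> 'a set \<Rightarrow> outcome" where
  "weigh X L R =
    (if card (X \<inter> L) < card (X \<inter> R) then Lt
     else if card (X \<inter> L) = card (X \<inter> R) then Eq
     else Gt)"

text \<open>
  In \<open>Weigh L R s t u\<close> the coins in \<open>L\<close> are compared with those in \<open>R\<close>, and the strategy continues
  with \<open>s\<close>, \<open>t\<close> or \<open>u\<close> if the outcome is \<open>Lt\<close>, \<open>Eq\<close> or \<open>Gt\<close>, respectively.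
\<close>

datatype 'a strategy =
  Stop
| Weigh "'a set" "'a set" "'a strategy" "'a strategy" "'a strategy"

primrec strategy_on :: "'a set \<Rightarrow> 'a strategy \<Rightarrow> bool" where
  "strategy_on S Stop \<longleftrightarrow> True"
| "strategy_on S (Weigh L R s t u) \<longleftrightarrow>
     L \<subseteq> S \<and> R \<subseteq> S \<and> L \<inter> R = {} \<and> strategy_on S s \<and> strategy_on S t \<and> strategy_on S u"

primrec outcomes :: "'a strategy \<Rightarrow> 'a set \<Rightarrow> outcome list" where
  "outcomes Stop X = []"
| "outcomes (Weigh L R s t u) X =
     (case weigh X L R of
        Lt \<Rightarrow> Lt # outcomes s X
      | Eq \<Rightarrow> Eq # outcomes t X
      | Gt \<Rightarrow> Gt # outcomes u X)"

definition finds_all_fakes :: "'a set \<Rightarrow> 'a strategy \<Rightarrow> bool" where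
  "finds_all_fakes S t \<longleftrightarrow> inj_on (outcomes t) (Pow S)"

definition weighings_suffice :: "'a set \<Rightarrow> nat \<Rightarrow> bool" where
  "weighings_suffice S k \<longleftrightarrow>
     (\<exists>t. strategy_on S t \<and> finds_all_fakes S t \<and> (\<forall>X\<in>Pow S. length (outcomes t X) \<le> k))"

definition g :: "nat \<Rightarrow> nat" where
  "g n = (LEAST k. weighings_suffice {1..n} k)"

text \<open>
  The minimum in the definition of \<open>g\<close> exists: each coin can be weighed separately against a
  genuine one.
\<close>

primrec one_by_one :: "'a list \<Rightarrow> 'a strategy" where
  "one_by_one [] = Stop"
| "one_by_one (x # xs) = Weigh {x} {} (one_by_one xs) (one_by_one xs) (one_by_one xs)"

lemma weigh_singleton: "weigh X {x} {} = (if x \<in> X then Gt else Eq)"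
  by (simp add: weigh_def)

lemma outcomes_one_by_one:
  "outcomes (one_by_one xs) X = map (\<lambda>x. if x \<in> X then Gt else Eq) xs"
  by (induction xs) (simp_all add: weigh_singleton)

lemma strategy_on_one_by_one: "set xs \<subseteq> S \<Longrightarrow> strategy_on S (one_by_one xs)"
  by (induction xs) simp_all

lemma weighings_suffice_card:
  assumes "finite S"
  shows "weighings_suffice S (card S)"
proof -
  obtain xs where xs: "set xs = S" "length xs = card S"
    using assms by (metis finite_distinct_list distinct_card)
  have "finds_all_fakes S (one_by_one xs)"
    unfolding finds_all_fakes_def
  proof (rule inj_onI)
    fix X Y
    assume "X \<in> Pow S" "Y \<in> Pow S" "outcomes (one_by_one xs) X = outcomes (one_by_one xs) Y"
    moreover from this have "\<forall>x\<in>S. x \<in> X \<longleftrightarrow> x \<in> Y"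
      using xs by (auto simp: outcomes_one_by_one split: if_splits)
    ultimately show "X = Y"
      by blast
  qed
  moreover have "strategy_on S (one_by_one xs)"
    using xs by (simp add: strategy_on_one_by_one)
  moreover have "\<forall>X\<in>Pow S. length (outcomes (one_by_one xs) X) \<le> card S"
    using xs by (simp add: outcomes_one_by_one)
  ultimately show ?thesis
    unfolding weighings_suffice_def by blast
qed

lemma weighings_suffice_g: "weighings_suffice {1..n} (g n)"
  unfolding g_def by (rule LeastI, rule weighings_suffice_card) simp

end

theory Submission
  imports Defs
begin

text \<open>
  The sum is \<open>138267 / 2 ^ 17 * 2 ^ n\<close>, and \<open>138267 = 81 * 1707\<close>. So it suffices that after four weighings some
  class of subsets that are still possible has a share of at least \<open>1707 / 2 ^ 17\<close>.

  Unless three coins are weighed against three, the first weighing has a class of share at least \<open>23 / 64\<close>,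
  which is enough. Otherwise follow the outcome \<open>Gt\<close>, which has share \<open>22 / 64\<close>. If a later weighing uses at least
  five fresh coins, then at most \<open>5 / 16\<close> of the class is balanced, and one of the other two outcomes is large
  enough. So each later weighing uses at most four fresh coins, and after the second, third and fourth one the
  shares are multiples of \<open>2 ^ -10\<close>, \<open>2 ^ -14\<close> and \<open>2 ^ -18\<close>. A finite check of the second weighings gives a class of
  share at least \<open>120 / 2 ^ 10\<close>. Dividing by three and rounding up to the next admissible share gives
  \<open>640 / 2 ^ 14\<close> and then \<open>3414 / 2 ^ 18 = 1707 / 2 ^ 17\<close>.
\<close>

section \<open>Balances, and families that ignore the unweighed coins\<close>

text \<open>The signed difference behind \<open>weigh\<close>. Unlike the outcome, it is additive
  over disjoint sets of coins.\<close>

definition balance :: "'a set \<Rightarrow> 'a set \<Rightarrow> 'a set \<Rightarrow> int" where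
  "balance L R X = int (card (X \<inter> L)) - int (card (X \<inter> R))"

lemma weigh_iff_balance:
  "weigh X L R = Lt \<longleftrightarrow> balance L R X < 0"
  "weigh X L R = Eq \<longleftrightarrow> balance L R X = 0"
  "weigh X L R = Gt \<longleftrightarrow> balance L R X > 0"
  by (auto simp: weigh_def balance_def)

lemma balance_Un:
  assumes "finite X" "finite Y" "X \<inter> Y = {}"
  shows "balance L R (X \<union> Y) = balance L R X + balance L R Y"
proof -
  have "card ((X \<union> Y) \<inter> M) = card (X \<inter> M) + card (Y \<inter> M)" for M
    using assms by (subst Int_Un_distrib2, intro card_Un_disjoint) auto
  then show ?thesis
    by (simp add: balance_def)
qed

lemma balance_Int:
  assumes "L \<union> R \<subseteq> D"
  shows "balance L R (X \<inter> D) = balance L R X"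
  using assms by (simp add: balance_def Int_assoc inf.absorb2)

text \<open>
  An insensitive family does not depend on the coins in \<open>W\<close>, that is, on the coins that have not
  been weighed yet.
\<close>

definition insensitive :: "'a set \<Rightarrow> 'a set set \<Rightarrow> bool" where
  "insensitive W F \<longleftrightarrow> (\<forall>X\<in>F. \<forall>Y\<subseteq>W. X - W \<union> Y \<in> F)"

lemma insensitive_Pow: "W \<subseteq> S \<Longrightarrow> insensitive W (Pow S)"
  by (auto simp: insensitive_def)

text \<open>Changing \<open>X\<close> on \<open>V\<close> is a change on \<open>W\<close> in which
  the coins of \<open>W - V\<close> are put back as they are in \<open>X\<close>.\<close>

lemma insensitive_subset:
  assumes "insensitive W F" "V \<subseteq> W"
  shows "insensitive V F"
  unfolding insensitive_def
proof (intro ballI allI impI)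
  fix X Y
  assume "X \<in> F" "Y \<subseteq> V"
  moreover have "X - V \<union> Y = X - W \<union> ((X \<inter> W - V) \<union> Y)"
    using \<open>V \<subseteq> W\<close> by auto
  moreover have "(X \<inter> W - V) \<union> Y \<subseteq> W"
    using \<open>Y \<subseteq> V\<close> \<open>V \<subseteq> W\<close> by auto
  ultimately show "X - V \<union> Y \<in> F"
    using assms(1) unfolding insensitive_def by metis
qed

lemma insensitive_balance:
  assumes "insensitive W F"
  shows "insensitive (W - (L \<union> R)) {X \<in> F. Q (balance L R X)}"
proof -
  have "balance L R (X - (W - (L \<union> R)) \<union> Y) = balance L R X" if "Y \<subseteq> W - (L \<union> R)" for X Y
  proof -
    have "(X - (W - (L \<union> R)) \<union> Y) \<inter> (L \<union> R) = X \<inter> (L \<union> R)"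
      using that by auto
    then show ?thesis
      by (metis balance_Int order_refl)
  qed
  with insensitive_subset[OF assms, of "W - (L \<union> R)"] show ?thesis
    by (simp add: insensitive_def)
qed

text \<open>Every member splits uniquely into a part outside \<open>W\<close> and a part inside
  \<open>W\<close>, and insensitivity makes all combinations of such parts occur.\<close>

lemma sum_insensitive:
  assumes "insensitive W F"
  shows "(\<Sum>X\<in>F. f X) = (\<Sum>X | X \<in> F \<and> X \<inter> W = {}. \<Sum>Y\<in>Pow W. f (X \<union> Y))"
proof -
  let ?G = "{X \<in> F. X \<inter> W = {}}"
  have "bij_betw (\<lambda>(X, Y). X \<union> Y) (?G \<times> Pow W) F"
  proof (rule bij_betw_byWitness[where f' = "\<lambda>X. (X - W, X \<inter> W)"])
    show "\<forall>a\<in>?G \<times> Pow W. (\<lambda>X. (X - W, X \<inter> W)) ((\<lambda>(X, Y). X \<union> Y) a) = a"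
      by auto
    show "\<forall>a\<in>F. (\<lambda>(X, Y). X \<union> Y) (a - W, a \<inter> W) = a"
      by auto
    show "(\<lambda>(X, Y). X \<union> Y) ` (?G \<times> Pow W) \<subseteq> F"
    proof clarify
      fix X Y assume "X \<in> F" "X \<inter> W = {}" "Y \<subseteq> W"
      moreover from this have "X - W = X"
        by auto
      ultimately show "X \<union> Y \<in> F"
        using assms unfolding insensitive_def by metis
    qed
    have "X - W \<in> F" if "X \<in> F" for X
      using assms that unfolding insensitive_def by (metis Un_empty_right empty_subsetI)
    then show "(\<lambda>X. (X - W, X \<inter> W)) ` F \<subseteq> ?G \<times> Pow W"
      by auto
  qed
  then have "(\<Sum>X\<in>F. f X) = (\<Sum>(X, Y)\<in>?G \<times> Pow W. f (X \<union> Y))"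
    by (subst sum.reindex_bij_betw[symmetric]) (auto simp: case_prod_unfold)
  then show ?thesis
    by (simp add: sum.cartesian_product)
qed

lemma card_insensitive:
  assumes "insensitive W F" "finite W" "finite F"
  shows "card F = 2 ^ card W * card {X \<in> F. X \<inter> W = {}}"
  using sum_insensitive[OF assms(1), of "\<lambda>_. 1 :: nat"] assms(2)
  by (simp add: card_Pow)

lemma sum_Pow_card:
  fixes f :: "nat \<Rightarrow> 'b :: comm_semiring_1"
  assumes "finite W"
  shows "(\<Sum>Y\<in>Pow W. f (card Y)) = (\<Sum>k\<le>card W. of_nat (card W choose k) * f k)"
proof -
  have "(\<Sum>k\<le>card W. \<Sum>Y | Y \<in> Pow W \<and> card Y = k. f (card Y)) = (\<Sum>Y\<in>Pow W. f (card Y))"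
    using assms by (intro sum.group) (auto simp: card_mono)
  moreover have "(\<Sum>Y | Y \<in> Pow W \<and> card Y = k. f (card Y)) = of_nat (card W choose k) * f k" for k
    using n_subsets[OF assms, of k] by simp
  ultimately show ?thesis
    by simp
qed

text \<open>
  Replacing \<open>Y \<inter> R\<close> by its complement in \<open>W \<inter> R\<close> turns the balance of \<open>Y\<close> into a cardinality,
  up to a constant.
\<close>

lemma sum_Pow_balance:
  fixes f :: "int \<Rightarrow> 'b :: comm_semiring_1"
  assumes "finite W" "L \<inter> R = {}"
  defines "m \<equiv> card (W \<inter> (L \<union> R))"
  shows "(\<Sum>Y\<in>Pow W. f (balance L R Y)) =
    2 ^ (card W - m) * (\<Sum>k\<le>m. of_nat (m choose k) * f (int k - int (card (W \<inter> R))))"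
proof -
  let ?V = "W \<inter> (L \<union> R)" and ?Q = "W \<inter> R"
  let ?flip = "\<lambda>Y. (Y - ?Q) \<union> (?Q - Y)"
  have fin: "finite ?V" "finite ?Q"
    using assms(1) by auto
  have flip: "balance L R Y = int (card (?flip Y)) - int (card ?Q)" if "Y \<subseteq> ?V" for Y
  proof -
    have "finite Y"
      using that fin finite_subset by blast
    have "card (?flip Y) = card (Y - ?Q) + card (?Q - Y)"
      using fin \<open>finite Y\<close> by (intro card_Un_disjoint) auto
    moreover have "Y - ?Q = Y \<inter> L"
      using that \<open>L \<inter> R = {}\<close> by auto
    moreover have "card (?Q - Y) + card (Y \<inter> R) = card ?Q"
    proof -
      have "?Q = (?Q - Y) \<union> (Y \<inter> R)"
        using that by auto
      moreover have "card ((?Q - Y) \<union> (Y \<inter> R)) = card (?Q - Y) + card (Y \<inter> R)"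
        using fin \<open>finite Y\<close> by (intro card_Un_disjoint) auto
      ultimately show ?thesis
        by metis
    qed
    ultimately show ?thesis
      by (simp add: balance_def)
  qed
  have bij: "bij_betw ?flip (Pow ?V) (Pow ?V)"
    by (rule bij_betw_byWitness[where f' = ?flip]) auto
  have "(\<Sum>Y\<in>Pow W. f (balance L R Y)) =
      (\<Sum>Z | Z \<in> Pow W \<and> Z \<inter> (W - ?V) = {}. \<Sum>Y\<in>Pow (W - ?V). f (balance L R (Z \<union> Y)))"
    by (rule sum_insensitive, rule insensitive_Pow) auto
  also have "{Z. Z \<in> Pow W \<and> Z \<inter> (W - ?V) = {}} = Pow ?V"
    by auto
  also have "(\<Sum>Z\<in>Pow ?V. \<Sum>Y\<in>Pow (W - ?V). f (balance L R (Z \<union> Y))) =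
      (\<Sum>Z\<in>Pow ?V. 2 ^ card (W - ?V) * f (balance L R Z))"
  proof (rule sum.cong[OF refl])
    fix Z assume "Z \<in> Pow ?V"
    have "balance L R (Z \<union> Y) = balance L R Z" if "Y \<in> Pow (W - ?V)" for Y
    proof -
      have "(Z \<union> Y) \<inter> (L \<union> R) = Z \<inter> (L \<union> R)"
        using that by auto
      then show ?thesis
        by (metis balance_Int order_refl)
    qed
    then show "(\<Sum>Y\<in>Pow (W - ?V). f (balance L R (Z \<union> Y))) = 2 ^ card (W - ?V) * f (balance L R Z)"
      using assms(1) by (simp add: card_Pow)
  qed
  also have "\<dots> = 2 ^ card (W - ?V) * (\<Sum>Z\<in>Pow ?V. f (int (card (?flip Z)) - int (card ?Q)))"
    by (simp add: sum_distrib_left flip)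
  also have "(\<Sum>Z\<in>Pow ?V. f (int (card (?flip Z)) - int (card ?Q))) =
      (\<Sum>Z\<in>Pow ?V. f (int (card Z) - int (card ?Q)))"
    using sum.reindex_bij_betw[OF bij, of "\<lambda>Z. f (int (card Z) - int (card ?Q))"] by simp
  also have "\<dots> = (\<Sum>k\<le>m. of_nat (m choose k) * f (int k - int (card ?Q)))"
    unfolding m_def by (rule sum_Pow_card[OF fin(1)])
  also have "card (W - ?V) = card W - m"
    unfolding m_def by (rule card_Diff_subset[OF fin(1)]) auto
  finally show ?thesis .
qed

lemma card_eq_sum_if:
  assumes "finite F"
  shows "int (card {X \<in> F. Q X}) = (\<Sum>X\<in>F. if Q X then 1 else 0)"
  using assms by (simp add: sum.If_cases Int_def)

text \<open>Fix the coins outside \<open>W\<close>. After the flip of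
  \<open>sum_Pow_balance\<close>, balance zero prescribes the cardinality of the part inside
  \<open>W\<close>, so at most a central binomial coefficient of the \<open>2 ^ card W\<close>
  choices is balanced.\<close>

lemma card_balanced_le:
  assumes ins: "insensitive W F" and F: "F \<subseteq> Pow S" and S: "finite S" and "W \<subseteq> S"
    and LR: "W \<subseteq> L \<union> R" "L \<inter> R = {}"
  shows "2 ^ card W * card {X \<in> F. balance L R X = 0} \<le> (card W choose (card W div 2)) * card F"
proof -
  let ?m = "card W" and ?G = "{X \<in> F. X \<inter> W = {}}"
  have finW: "finite W"
    using \<open>W \<subseteq> S\<close> S finite_subset by blast
  have finF: "finite F"
    using F S by (meson finite_Pow_iff finite_subset)
  have *: "(\<Sum>Y\<in>Pow W. if balance L R (X \<union> Y) = 0 then 1 else 0) \<le> int (?m choose (?m div 2))"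
    if "X \<in> ?G" for X
  proof -
    have "finite X"
      using that F S by (metis (no_types, lifting) Pow_iff finite_subset mem_Collect_eq subsetD)
    let ?c = "int (card (W \<inter> R)) - balance L R X"
    have "(\<Sum>Y\<in>Pow W. if balance L R (X \<union> Y) = 0 then 1 else 0 :: int) =
        (\<Sum>Y\<in>Pow W. (\<lambda>b. if balance L R X + b = 0 then 1 else 0) (balance L R Y))"
      using that finW \<open>finite X\<close>
      by (intro sum.cong refl) (subst balance_Un, auto intro: finite_subset)
    also have "\<dots> = (\<Sum>k\<le>?m. int (?m choose k) * (if int k = ?c then 1 else 0))"
      unfolding sum_Pow_balance[OF finW LR(2), of "\<lambda>b. if balance L R X + b = 0 then 1 else 0 :: int"]
      using LR(1) by (simp add: inf.absorb1 algebra_simps)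
    \<comment> \<open>For negative \<open>?c\<close> all terms on the left vanish, so the value
      \<open>nat ?c = 0\<close> does no harm.\<close>
    also have "\<dots> \<le> (\<Sum>k\<le>?m. if k = nat ?c then int (?m choose (?m div 2)) else 0)"
      by (intro sum_mono) (auto simp: binomial_maximum)
    also have "\<dots> \<le> int (?m choose (?m div 2))"
      by simp
    finally show ?thesis .
  qed
  have "int (card {X \<in> F. balance L R X = 0}) =
      (\<Sum>X\<in>?G. \<Sum>Y\<in>Pow W. if balance L R (X \<union> Y) = 0 then 1 else 0)"
    by (simp only: card_eq_sum_if[OF finF] sum_insensitive[OF ins])
  also have "\<dots> \<le> int (?m choose (?m div 2)) * int (card ?G)"
    using sum_bounded_above[of ?G, OF *] by (simp add: mult.commute)
  finally have "card {X \<in> F. balance L R X = 0} \<le> (?m choose (?m div 2)) * card ?G"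
    by (simp flip: of_nat_mult)
  then show ?thesis
    by (simp add: card_insensitive[OF ins finW finF] mult.left_commute)
qed

section \<open>Strategies for arbitrary families and the counting bound\<close>

text \<open>For \<open>F = Pow S\<close> this is \<open>weighings_suffice S k\<close>. A general
  family is allowed so that the notion passes to the class of subsets left after an outcome.\<close>

definition distinguishable :: "'a set \<Rightarrow> 'a set set \<Rightarrow> nat \<Rightarrow> bool" where
  "distinguishable S F k \<longleftrightarrow>
     (\<exists>t. strategy_on S t \<and> inj_on (outcomes t) F \<and> (\<forall>X\<in>F. length (outcomes t X) \<le> k))"

lemma distinguishable_Suc:
  assumes "distinguishable S F (Suc k)"
  obtains L R where "L \<subseteq> S" "R \<subseteq> S" "L \<inter> R = {}"
    "\<And>a. distinguishable S {X \<in> F. weigh X L R = a} k"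
proof -
  obtain t where t: "strategy_on S t" "inj_on (outcomes t) F"
      "\<And>X. X \<in> F \<Longrightarrow> length (outcomes t X) \<le> Suc k"
    using assms unfolding distinguishable_def by blast
  show thesis
  proof (cases t)
    case Stop
    \<comment> \<open>Stopping early is treated as a weighing with empty pans, after which
      \<open>Stop\<close> still separates each class.\<close>
    have "distinguishable S {X \<in> F. weigh X {} {} = a} k" for a
      unfolding distinguishable_def
      by (rule exI[of _ Stop]) (use t(2) Stop in \<open>auto simp: inj_on_def\<close>)
    with that[of "{}" "{}"] show thesis
      by simp
  next
    case (Weigh L R s\<^sub>l s\<^sub>e s\<^sub>g)
    define sub where "sub a = (case a of Lt \<Rightarrow> s\<^sub>l | Eq \<Rightarrow> s\<^sub>e | Gt \<Rightarrow> s\<^sub>g)" for a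
    have out: "outcomes t X = weigh X L R # outcomes (sub (weigh X L R)) X" for X
      by (simp add: Weigh sub_def split: outcome.split)
    have "distinguishable S {X \<in> F. weigh X L R = a} k" for a
      unfolding distinguishable_def
    proof (intro exI[of _ "sub a"] conjI ballI)
      show "strategy_on S (sub a)"
        using t(1) by (simp add: Weigh sub_def split: outcome.split)
      show "inj_on (outcomes (sub a)) {X \<in> F. weigh X L R = a}"
        using t(2) by (auto simp: inj_on_def out)
      show "length (outcomes (sub a) X) \<le> k" if "X \<in> {X \<in> F. weigh X L R = a}" for X
        using that t(3)[of X] by (auto simp: out)
    qed
    with that[of L R] t(1) show thesis
      by (simp add: Weigh)
  qed
qed

lemma card_weigh:
  assumes "finite F"
  shows "card F = card {X \<in> F. weigh X L R = Lt} + card {X \<in> F. weigh X L R = Eq}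
    + card {X \<in> F. weigh X L R = Gt}"
proof -
  have "F = {X \<in> F. weigh X L R = Lt} \<union> {X \<in> F. weigh X L R = Eq} \<union> {X \<in> F. weigh X L R = Gt}"
    using outcome.exhaust by blast
  moreover have "card ({X \<in> F. weigh X L R = Lt} \<union> {X \<in> F. weigh X L R = Eq} \<union> {X \<in> F. weigh X L R = Gt})
    = card {X \<in> F. weigh X L R = Lt} + card {X \<in> F. weigh X L R = Eq} + card {X \<in> F. weigh X L R = Gt}"
    using assms by (subst card_Un_disjoint, simp, simp, force)+ simp
  ultimately show ?thesis
    by simp
qed

lemma distinguishable_card_le:
  assumes "distinguishable S F k" "finite F"
  shows "card F \<le> 3 ^ k"
  using assms
proof (induction k arbitrary: F)
  case 0
  then have "inj_on (\<lambda>X. [] :: outcome list) F"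
    unfolding distinguishable_def by (auto cong: inj_on_cong)
  then have "card F \<le> card {[] :: outcome list}"
    by (rule card_inj_on_le) auto
  then show ?case
    by simp
next
  case (Suc k)
  obtain L R where "\<And>a. distinguishable S {X \<in> F. weigh X L R = a} k"
    using distinguishable_Suc[OF Suc.prems(1)] by metis
  then have "card {X \<in> F. weigh X L R = a} \<le> 3 ^ k" for a
    using Suc.prems(2) by (intro Suc.IH) auto
  from this[of Lt] this[of Eq] this[of Gt] show ?case
    unfolding card_weigh[OF Suc.prems(2), of L R] by simp
qed

section \<open>Computable counts and the finite checks\<close>

text \<open>Pascal's recursion with integer values, in a form that \<open>code_simp\<close>
  evaluates.\<close>

fun binom :: "nat \<Rightarrow> nat \<Rightarrow> int" where
  "binom n 0 = 1"
| "binom 0 (Suc k) = 0"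
| "binom (Suc n) (Suc k) = binom n k + binom n (Suc k)"

lemma binom_eq: "binom n k = int (n choose k)"
  by (induction n k rule: binom.induct) simp_all

text \<open>
  An entry \<open>(w, l)\<close> stands for the \<open>w\<close> subsets of a union of disjoint blocks of sizes \<open>ns\<close> that meet the
  blocks in \<open>l ! 0\<close>, \<open>l ! 1\<close>, \<dots> coins.
\<close>

primrec size_profiles :: "nat list \<Rightarrow> (int \<times> nat list) list" where
  "size_profiles [] = [(1, [])]"
| "size_profiles (n # ns) =
     concat (map (\<lambda>k. map (\<lambda>(w, l). (binom n k * w, k # l)) (size_profiles ns)) [0..<Suc n])"

text \<open>
  Let \<open>m\<close> fresh coins be weighed, \<open>q\<close> of them on the right pan. An entry \<open>(w, d)\<close> of \<open>t\<close> stands for \<open>w\<close> sets of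
  old counterfeit coins with balance \<open>d\<close>. Then \<open>hits P m q t\<close> counts the sets whose total balance satisfies \<open>P\<close>.
\<close>

definition shifted :: "(int \<Rightarrow> bool) \<Rightarrow> nat \<Rightarrow> nat \<Rightarrow> int \<Rightarrow> int" where
  "shifted P m q d = (\<Sum>k\<leftarrow>[0..<Suc m]. if P (d + int k - int q) then binom m k else 0)"

definition hits :: "(int \<Rightarrow> bool) \<Rightarrow> nat \<Rightarrow> nat \<Rightarrow> (int \<times> int) list \<Rightarrow> int" where
  "hits P m q t = (\<Sum>(w, d)\<leftarrow>t. w * shifted P m q d)"

text \<open>Since \<open>2 ^ m\<close> counts the choices of the weighed fresh coins, each disjunct
  says that \<open>hits / 2 ^ m\<close> is at least \<open>c / 64\<close>, cleared of
  denominators.\<close>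

definition max_hits_ge :: "int \<Rightarrow> nat \<Rightarrow> nat \<Rightarrow> (int \<times> int) list \<Rightarrow> bool" where
  "max_hits_ge c m q t \<longleftrightarrow> c * 2 ^ m \<le> 64 * hits (\<lambda>b. b = 0) m q t \<or>
     c * 2 ^ m \<le> 64 * hits (\<lambda>b. b > 0) m q t \<or> c * 2 ^ m \<le> 64 * hits (\<lambda>b. b < 0) m q t"

text \<open>
  Here \<open>A\<close> and \<open>B\<close> are the pans of the first weighing, \<open>L\<close> and \<open>R\<close> those of the second one, and the profile
  \<open>l\<close> refers to the blocks \<open>A \<inter> L\<close>, \<open>A \<inter> R\<close>, \<open>A - L - R\<close>, \<open>B \<inter> L\<close>, \<open>B \<inter> R\<close>, \<open>B - L - R\<close>.
\<close>

definition old_balance :: "nat list \<Rightarrow> int" where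
  "old_balance l = int (l ! 0 + l ! 1 + l ! 2) - int (l ! 3 + l ! 4 + l ! 5)"

definition new_balance :: "nat list \<Rightarrow> int" where
  "new_balance l = int (l ! 0 + l ! 3) - int (l ! 1 + l ! 4)"

definition heavy_profiles :: "nat list \<Rightarrow> (int \<times> int) list" where
  "heavy_profiles ns =
     map (\<lambda>(w, l). (w, new_balance l)) (filter (\<lambda>(w, l). old_balance l > 0) (size_profiles ns))"

text \<open>Merging entries of equal balance preserves \<open>hits\<close> and keeps the evaluated
  tables short: six old coins give at most seven balances for a fixed distribution over the
  pans.\<close>

fun add_weight :: "int \<times> int \<Rightarrow> (int \<times> int) list \<Rightarrow> (int \<times> int) list" where
  "add_weight (w, d) [] = [(w, d)]"
| "add_weight (w, d) ((w', d') # t) =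
     (if d = d' then (w + w', d) # t else (w', d') # add_weight (w, d) t)"

lemma hits_add_weight: "hits P m q (add_weight (w, d) t) = w * shifted P m q d + hits P m q t"
  by (induction "(w, d)" t rule: add_weight.induct) (auto simp: hits_def algebra_simps)

lemma hits_merge: "hits P m q (foldr add_weight t []) = hits P m q t"
  by (induction t) (auto simp: hits_add_weight, auto simp: hits_def)

text \<open>The table \<open>[(1, 0)]\<close> stands for the empty set, as no coin is old yet. The
  exception \<open>(6, 3)\<close> is three coins against three, where the largest share is only
  \<open>22 / 64\<close>.\<close>

lemma first_weighing_check:
  "\<forall>m\<in>set [0..<7]. \<forall>q\<in>set [0..<Suc m]. (m, q) = (6, 3) \<or> max_hits_ge 23 m q [(1, 0)]"
  by code_simp

text \<open>
  The constant \<open>480\<close> is \<open>64 * 15 / 2\<close>: some class is to contain at least \<open>15 / 128\<close> of all subsets. This is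
  a separate constant so that its argument is normalised before it is duplicated.
\<close>

definition some_class_large :: "(int \<times> int) list \<Rightarrow> bool" where
  "some_class_large t \<longleftrightarrow>
     list_all (\<lambda>m. list_all (\<lambda>q. max_hits_ge 480 m q t) [0..<Suc m]) [0..<5]"

text \<open>\<open>a\<close> and \<open>b\<close> are the numbers of coins of the first left pan
  that go on the left and right pan of the second weighing; \<open>c\<close> and \<open>d\<close>
  are those of the first right pan.\<close>

definition second_weighing_ok :: "nat \<Rightarrow> nat \<Rightarrow> nat \<Rightarrow> nat \<Rightarrow> bool" where
  "second_weighing_ok a b c d \<longleftrightarrow>
     some_class_large (foldr add_weight (heavy_profiles [a, b, 3 - a - b, c, d, 3 - c - d]) [])"

text \<open>There are 100 distributions of the old coins, each with 15 ways to put at most four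
  fresh coins on the pans, counted by numbers only.\<close>

lemma second_weighing_check:
  "list_all (\<lambda>a. list_all (\<lambda>b. list_all (\<lambda>c. list_all (\<lambda>d. second_weighing_ok a b c d)
     [0..<4 - c]) [0..<4]) [0..<4 - a]) [0..<4]"
  by code_simp

section \<open>Correctness of the computed counts\<close>

lemma sum_list_concat: "sum_list (concat xss) = sum_list (map sum_list xss)"
  for xss :: "'b :: monoid_add list list"
  by (induction xss) simp_all

lemma sum_Pow_disjoint_Un:
  assumes "A \<inter> B = {}"
  shows "(\<Sum>X\<in>Pow (A \<union> B). f X) = (\<Sum>X\<in>Pow B. \<Sum>Y\<in>Pow A. f (X \<union> Y))"
proof -
  have "{X. X \<in> Pow (A \<union> B) \<and> X \<inter> A = {}} = Pow B"
    using assms by auto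
  with sum_insensitive[OF insensitive_Pow[of A "A \<union> B"], of f] show ?thesis
    by simp
qed

lemma sum_size_profiles_Cons:
  "(\<Sum>(w, l)\<leftarrow>size_profiles (n # ns). w * h l) =
    (\<Sum>k\<leftarrow>[0..<Suc n]. binom n k * (\<Sum>(w, l)\<leftarrow>size_profiles ns. w * h (k # l)))"
proof -
  have "(\<Sum>(w, l)\<leftarrow>map (\<lambda>(w, l). (binom n k * w, k # l)) xs. w * h l) =
      binom n k * (\<Sum>(w, l)\<leftarrow>xs. w * h (k # l))" for k xs
    by (induction xs) (auto simp: algebra_simps)
  then show ?thesis
    by (simp only: size_profiles.simps map_concat sum_list_concat map_map comp_def)
qed

text \<open>The parts of a subset in disjoint blocks are chosen independently. The induction splits
  off the first block and groups its subsets by size.\<close>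

lemma sum_size_profiles:
  assumes "\<And>B. B \<in> set Bs \<Longrightarrow> finite B" "sorted_wrt disjnt Bs"
  shows "(\<Sum>X\<in>Pow (\<Union>(set Bs)). h (map (\<lambda>B. card (X \<inter> B)) Bs)) =
    (\<Sum>(w, l)\<leftarrow>size_profiles (map card Bs). w * h l)"
  using assms
proof (induction Bs arbitrary: h)
  case Nil
  then show ?case
    by simp
next
  case (Cons B Bs)
  let ?D = "\<Union>(set Bs)"
  have disj: "B \<inter> ?D = {}" and "finite B"
    using Cons.prems by (auto simp: disjnt_def)
  have sizes: "map (\<lambda>B. card ((Z \<union> Y) \<inter> B)) (B # Bs) = card Y # map (\<lambda>B. card (Z \<inter> B)) Bs"
    if "Y \<in> Pow B" "Z \<in> Pow ?D" for Y Z
  proof -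
    have "(Z \<union> Y) \<inter> B = Y" "\<And>C. C \<in> set Bs \<Longrightarrow> (Z \<union> Y) \<inter> C = Z \<inter> C"
      using that disj by auto
    then show ?thesis
      by simp
  qed
  have "(\<Sum>X\<in>Pow (\<Union>(set (B # Bs))). h (map (\<lambda>B. card (X \<inter> B)) (B # Bs))) =
      (\<Sum>Z\<in>Pow ?D. \<Sum>Y\<in>Pow B. h (map (\<lambda>B. card ((Z \<union> Y) \<inter> B)) (B # Bs)))"
    using sum_Pow_disjoint_Un[OF disj, of "\<lambda>X. h (map (\<lambda>B. card (X \<inter> B)) (B # Bs))"] by simp
  also have "\<dots> = (\<Sum>Z\<in>Pow ?D. \<Sum>Y\<in>Pow B. h (card Y # map (\<lambda>B. card (Z \<inter> B)) Bs))"
    by (intro sum.cong refl arg_cong[of _ _ h] sizes)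
  also have "\<dots> = (\<Sum>Y\<in>Pow B. \<Sum>Z\<in>Pow ?D. h (card Y # map (\<lambda>B. card (Z \<inter> B)) Bs))"
    by (rule sum.swap)
  also have "\<dots> = (\<Sum>Y\<in>Pow B. \<Sum>(w, l)\<leftarrow>size_profiles (map card Bs). w * h (card Y # l))"
    using Cons.prems by (intro sum.cong refl Cons.IH) auto
  also have "\<dots> = (\<Sum>k\<le>card B. binom (card B) k *
      (\<Sum>(w, l)\<leftarrow>size_profiles (map card Bs). w * h (k # l)))"
    using sum_Pow_card[OF \<open>finite B\<close>,
        of "\<lambda>k. \<Sum>(w, l)\<leftarrow>size_profiles (map card Bs). w * h (k # l)"]
    by (simp add: binom_eq)
  also have "\<dots> = (\<Sum>k\<leftarrow>[0..<Suc (card B)]. binom (card B) k *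
      (\<Sum>(w, l)\<leftarrow>size_profiles (map card Bs). w * h (k # l)))"
    by (simp only: sum_list_distinct_conv_sum_set distinct_upt set_upt atLeast0LessThan lessThan_Suc_atMost)
  also have "\<dots> = (\<Sum>(w, l)\<leftarrow>size_profiles (map card (B # Bs)). w * h l)"
    by (simp only: list.map sum_size_profiles_Cons)
  finally show ?case .
qed

lemma shifted_eq: "shifted P m q d = (\<Sum>k\<le>m. int (m choose k) * (if P (d + int k - int q) then 1 else 0))"
  unfolding shifted_def
  by (simp only: sum_list_distinct_conv_sum_set distinct_upt set_upt atLeast0LessThan lessThan_Suc_atMost)
    (intro sum.cong, auto simp: binom_eq)

lemma sum_Pow_balance_shifted:
  assumes "finite W" "L \<inter> R = {}"
  defines "m \<equiv> card (W \<inter> (L \<union> R))"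
  shows "(\<Sum>Y\<in>Pow W. if P (d + balance L R Y) then 1 else 0) =
    2 ^ (card W - m) * shifted P m (card (W \<inter> R)) d"
  using sum_Pow_balance[OF assms(1,2), of "\<lambda>b. if P (d + b) then 1 else 0 :: int"]
  by (simp add: m_def shifted_eq algebra_simps)

lemma balance_eq_profile:
  assumes "finite Z" "L \<inter> R = {}" "A \<inter> B = {}" "Z \<subseteq> A \<union> B"
  defines "l \<equiv> map (\<lambda>C. card (Z \<inter> C)) [A \<inter> L, A \<inter> R, A - L - R, B \<inter> L, B \<inter> R, B - L - R]"
  shows "balance A B Z = old_balance l" "balance L R Z = new_balance l"
proof -
  have Un: "card (Z \<inter> (C \<union> D)) = card (Z \<inter> C) + card (Z \<inter> D)" if "C \<inter> D = {}" for C D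
    using that assms(1) by (subst Int_Un_distrib, intro card_Un_disjoint) auto
  have three: "card (Z \<inter> C) = card (Z \<inter> (C \<inter> L)) + card (Z \<inter> (C \<inter> R)) + card (Z \<inter> (C - L - R))" for C
  proof -
    have "C = (C \<inter> L) \<union> (C \<inter> R) \<union> (C - L - R)"
      by auto
    moreover have "card (Z \<inter> ((C \<inter> L) \<union> (C \<inter> R) \<union> (C - L - R))) =
        card (Z \<inter> (C \<inter> L)) + card (Z \<inter> (C \<inter> R)) + card (Z \<inter> (C - L - R))"
      using assms(2) by (subst Un, force, subst Un, force, simp)
    ultimately show ?thesis
      by simp
  qed
  have two: "card (Z \<inter> M) = card (Z \<inter> (A \<inter> M)) + card (Z \<inter> (B \<inter> M))" for M
  proof -
    have "Z \<inter> M = Z \<inter> ((A \<inter> M) \<union> (B \<inter> M))"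
      using assms(4) by auto
    then show ?thesis
      using Un[of "A \<inter> M" "B \<inter> M"] assms(3) by (simp add: disjoint_iff)
  qed
  show "balance A B Z = old_balance l"
    by (simp add: balance_def old_balance_def l_def three[of A] three[of B])
  show "balance L R Z = new_balance l"
    by (simp add: balance_def new_balance_def l_def two[of L] two[of R])
qed

lemma hits_heavy_profiles:
  "hits P m q (heavy_profiles ns) =
    (\<Sum>(w, l)\<leftarrow>size_profiles ns. w * (if old_balance l > 0 then shifted P m q (new_balance l) else 0))"
proof -
  have "(\<Sum>(w, d)\<leftarrow>map (\<lambda>(w, l). (w, new_balance l)) (filter (\<lambda>(w, l). old_balance l > 0) xs).
      w * shifted P m q d) =
    (\<Sum>(w, l)\<leftarrow>xs. w * (if old_balance l > 0 then shifted P m q (new_balance l) else 0))" for xs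
    by (induction xs) auto
  then show ?thesis
    by (simp only: hits_def heavy_profiles_def)
qed

text \<open>Split each subset into an old part \<open>Z\<close> and a fresh part \<open>Y\<close>.
  The first weighing sees only \<open>Z\<close>, and in the second one the balances add up, so only
  the profile of \<open>Z\<close> matters. Fresh coins off the pans give the power of two.\<close>

lemma card_second_weighing:
  assumes S: "finite S" and AB: "A \<subseteq> S" "B \<subseteq> S" "A \<inter> B = {}"
    and LR: "L \<inter> R = {}"
  defines "W \<equiv> S - (A \<union> B)"
  defines "m \<equiv> card (W \<inter> (L \<union> R))"
  shows "int (card {X \<in> {X \<in> Pow S. balance A B X > 0}. P (balance L R X)}) =
    2 ^ (card W - m) * hits P m (card (W \<inter> R)) (heavy_profiles (map card
      [A \<inter> L, A \<inter> R, A - L - R, B \<inter> L, B \<inter> R, B - L - R]))"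
proof -
  let ?q = "card (W \<inter> R)" and ?Bs = "[A \<inter> L, A \<inter> R, A - L - R, B \<inter> L, B \<inter> R, B - L - R]"
  let ?f = "\<lambda>X. if balance A B X > 0 \<and> P (balance L R X) then 1 else 0 :: int"
  let ?h = "\<lambda>l. if old_balance l > 0 then shifted P m ?q (new_balance l) else 0"
  have fin: "finite W" "finite (A \<union> B)"
    using S AB finite_subset by (auto simp: W_def)
  have "int (card {X \<in> {X \<in> Pow S. balance A B X > 0}. P (balance L R X)}) = (\<Sum>X\<in>Pow S. ?f X)"
    using card_eq_sum_if[of "Pow S" "\<lambda>X. balance A B X > 0 \<and> P (balance L R X)"] S
    by (simp add: conj_assoc)
  also have "\<dots> = (\<Sum>Z\<in>Pow (A \<union> B). \<Sum>Y\<in>Pow W. ?f (Z \<union> Y))"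
  proof -
    have "S = W \<union> (A \<union> B)" "W \<inter> (A \<union> B) = {}"
      using AB by (auto simp: W_def)
    then show ?thesis
      using sum_Pow_disjoint_Un[of W "A \<union> B" ?f] by simp
  qed
  also have "\<dots> = (\<Sum>Z\<in>Pow (A \<union> B). 2 ^ (card W - m) * ?h (map (\<lambda>C. card (Z \<inter> C)) ?Bs))"
  proof (rule sum.cong[OF refl])
    fix Z assume Z: "Z \<in> Pow (A \<union> B)"
    then have "finite Z"
      using fin finite_subset by auto
    have "balance A B (Z \<union> Y) = balance A B Z \<and> balance L R (Z \<union> Y) = balance L R Z + balance L R Y"
      if "Y \<in> Pow W" for Y
    proof -
      have "finite Y"
        using that fin(1) finite_subset by auto
      moreover have "Z \<inter> Y = {}" "Y \<inter> A = {}" "Y \<inter> B = {}"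
        using that Z by (auto simp: W_def)
      ultimately show ?thesis
        using \<open>finite Z\<close> by (simp add: balance_Un) (simp add: balance_def)
    qed
    then have "(\<Sum>Y\<in>Pow W. ?f (Z \<union> Y)) =
        (if balance A B Z > 0 then \<Sum>Y\<in>Pow W. if P (balance L R Z + balance L R Y) then 1 else 0 else 0)"
      by simp
    also have "\<dots> = 2 ^ (card W - m) * (if balance A B Z > 0 then shifted P m ?q (balance L R Z) else 0)"
      by (simp add: sum_Pow_balance_shifted[OF fin(1) LR] m_def)
    finally show "(\<Sum>Y\<in>Pow W. ?f (Z \<union> Y)) = 2 ^ (card W - m) * ?h (map (\<lambda>C. card (Z \<inter> C)) ?Bs)"
      using balance_eq_profile[OF \<open>finite Z\<close> LR AB(3)] Z by simp
  qed
  also have "\<dots> = 2 ^ (card W - m) * (\<Sum>Z\<in>Pow (\<Union>(set ?Bs)). ?h (map (\<lambda>C. card (Z \<inter> C)) ?Bs))"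
  proof -
    have "\<Union>(set ?Bs) = A \<union> B"
      by auto
    then show ?thesis
      by (simp only: sum_distrib_left)
  qed
  also have "(\<Sum>Z\<in>Pow (\<Union>(set ?Bs)). ?h (map (\<lambda>C. card (Z \<inter> C)) ?Bs)) =
      (\<Sum>(w, l)\<leftarrow>size_profiles (map card ?Bs). w * ?h l)"
    using fin AB(3) LR by (intro sum_size_profiles) (auto simp: disjnt_def)
  also have "\<dots> = hits P m ?q (heavy_profiles (map card ?Bs))"
    by (rule hits_heavy_profiles[symmetric])
  finally show ?thesis .
qed

section \<open>Weighings with few fresh coins and rounding of shares\<close>

lemma insensitive_weigh:
  assumes "insensitive W F"
  shows "insensitive (W - (L \<union> R)) {X \<in> F. weigh X L R = a}"
  using insensitive_balance[OF assms, of L R "\<lambda>b. b < 0"] insensitive_balance[OF assms, of L R "\<lambda>b. b = 0"]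
    insensitive_balance[OF assms, of L R "\<lambda>b. b > 0"]
  by (cases a) (simp_all add: weigh_iff_balance)

text \<open>Five fresh coins on the pans limit the balanced share to \<open>10 / 32\<close>. The two
  other classes then hold at least \<open>22 / 32\<close> of \<open>F\<close> together, and each has
  at most \<open>3 ^ k\<close> members.\<close>

lemma distinguishable_few_fresh_coins:
  assumes S: "finite S" and k: "distinguishable S F (Suc k)" and F: "F \<subseteq> Pow S"
    and ins: "insensitive (S - U) F"
  obtains (many) "11 * card F \<le> 32 * 3 ^ k"
  | (few) L R where "L \<subseteq> S" "R \<subseteq> S" "L \<inter> R = {}" "card ((S - U) \<inter> (L \<union> R)) \<le> 4"
      "\<And>a. distinguishable S {X \<in> F. weigh X L R = a} k"
proof -
  have finF: "finite F"
    using S F by (meson finite_Pow_iff finite_subset)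
  obtain L R where LR: "L \<subseteq> S" "R \<subseteq> S" "L \<inter> R = {}"
    and sub: "\<And>a. distinguishable S {X \<in> F. weigh X L R = a} k"
    using distinguishable_Suc[OF k] by metis
  show thesis
  proof (cases "card ((S - U) \<inter> (L \<union> R)) \<le> 4")
    case True
    with few LR sub show thesis
      by blast
  next
    case False
    then have "5 \<le> card ((S - U) \<inter> (L \<union> R))"
      by simp
    then obtain W where W: "W \<subseteq> (S - U) \<inter> (L \<union> R)" "card W = 5"
      by (rule obtain_subset_with_card_n)
    then have "W \<subseteq> S - U" "W \<subseteq> S" "W \<subseteq> L \<union> R"
      by auto
    have choose: "5 choose 2 = (10 :: nat)"
      by (simp add: numeral_eq_Suc)
    have "insensitive W F"
      using ins \<open>W \<subseteq> S - U\<close> by (rule insensitive_subset)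
    from card_balanced_le[OF this F S \<open>W \<subseteq> S\<close> \<open>W \<subseteq> L \<union> R\<close> LR(3)]
    have "32 * card {X \<in> F. weigh X L R = Eq} \<le> 10 * card F"
      by (simp add: W(2) weigh_iff_balance choose)
    moreover have "card {X \<in> F. weigh X L R = a} \<le> 3 ^ k" for a
      using distinguishable_card_le[OF sub] finF by simp
    note this[of Lt] this[of Gt]
    ultimately have "11 * card F \<le> 32 * 3 ^ k"
      using card_weigh[OF finF, of L R] by linarith
    with many show thesis .
  qed
qed

lemma card_Un_fresh_le:
  assumes "finite S" "U \<subseteq> S" "L \<subseteq> S" "R \<subseteq> S" "card U \<le> u" "card ((S - U) \<inter> (L \<union> R)) \<le> 4"
  shows "card (U \<union> L \<union> R) \<le> u + 4"
proof -
  have "card (U \<union> L \<union> R) = card (U \<union> ((S - U) \<inter> (L \<union> R)))"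
    using assms by (intro arg_cong[of _ _ card]) auto
  then show ?thesis
    using card_Un_le[of U "(S - U) \<inter> (L \<union> R)"] assms(5,6) by linarith
qed

text \<open>The factor \<open>2 ^ u\<close> replaces the exponent \<open>card S - u\<close>, which
  would be truncated if \<open>u\<close> exceeded \<open>card S\<close>.\<close>

lemma dvd_card_insensitive:
  assumes S: "finite S" and "U \<subseteq> S" "card U \<le> u" and F: "F \<subseteq> Pow S" and ins: "insensitive (S - U) F"
  shows "2 ^ card S dvd 2 ^ u * card F"
proof -
  have "finite F"
    using F S by (meson finite_Pow_iff finite_subset)
  have "card S = card U + card (S - U)"
    using S \<open>U \<subseteq> S\<close> by (metis card_Diff_subset card_mono finite_subset le_add_diff_inverse)
  then have "(2 :: nat) ^ card S dvd 2 ^ u * 2 ^ card (S - U)"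
    using \<open>card U \<le> u\<close> by (simp add: power_add le_imp_power_dvd)
  then show ?thesis
    using card_insensitive[OF ins] S \<open>finite F\<close> by (simp flip: mult.assoc)
qed

text \<open>
  A family that depends on at most \<open>u\<close> coins has a size that is a multiple of \<open>2 ^ (card S - u)\<close>.
  Hence the share of the largest class is rounded up to the next multiple of \<open>2 ^ - (u + 4)\<close>.
\<close>

lemma distinguishable_largest_class:
  assumes S: "finite S" and k: "distinguishable S F (Suc k)" and F: "F \<subseteq> Pow S"
    and U: "U \<subseteq> S" "card U \<le> u" and ins: "insensitive (S - U) F"
    and c: "c * 2 ^ card S \<le> 2 ^ u * card F"
  obtains (many) "11 * card F \<le> 32 * 3 ^ k"
  | (few) F' U' where "distinguishable S F' k" "F' \<subseteq> Pow S" "U' \<subseteq> S" "card U' \<le> u + 4"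
      "insensitive (S - U') F'" "(16 * c + 2) div 3 * 2 ^ card S \<le> 2 ^ (u + 4) * card F'"
proof (rule distinguishable_few_fresh_coins[OF S k F ins])
  assume "11 * card F \<le> 32 * 3 ^ k"
  with many show thesis .
next
  fix L R
  assume LR: "L \<subseteq> S" "R \<subseteq> S" "L \<inter> R = {}" and fresh: "card ((S - U) \<inter> (L \<union> R)) \<le> 4"
    and sub: "\<And>a. distinguishable S {X \<in> F. weigh X L R = a} k"
  let ?C = "\<lambda>a. {X \<in> F. weigh X L R = a}" and ?U = "U \<union> L \<union> R"
  have finF: "finite F"
    using S F by (meson finite_Pow_iff finite_subset)
  have U': "?U \<subseteq> S" "card ?U \<le> u + 4"
    using card_Un_fresh_le[OF S U(1) LR(1,2) U(2) fresh] U LR by auto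
  have ins': "insensitive (S - ?U) (?C a)" for a
    using insensitive_weigh[OF ins] by (simp add: Diff_eq inf_assoc)
  have "2 ^ card S dvd 2 ^ (u + 4) * card (?C a)" for a
    using F by (intro dvd_card_insensitive[OF S U' _ ins']) auto
  then have "\<exists>w. \<forall>a. 2 ^ (u + 4) * card (?C a) = 2 ^ card S * w a"
    unfolding dvd_def by (intro choice) blast
  then obtain w where w: "\<And>a. 2 ^ (u + 4) * card (?C a) = 2 ^ card S * w a"
    by blast
  have "2 ^ card S * (16 * c) \<le> 2 ^ (u + 4) * card F"
    using c by (simp add: power_add mult.commute)
  also have "\<dots> = 2 ^ card S * (w Lt + w Eq + w Gt)"
    by (simp only: card_weigh[OF finF, of L R] distrib_left w)
  finally have "16 * c \<le> w Lt + w Eq + w Gt"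
    by simp
  \<comment> \<open>The bound is \<open>16 * c / 3\<close> rounded up: the largest of three integers
    with sum at least \<open>16 * c\<close> reaches it.\<close>
  then have "(16 * c + 2) div 3 \<le> w Lt \<or> (16 * c + 2) div 3 \<le> w Eq \<or> (16 * c + 2) div 3 \<le> w Gt"
    by linarith
  then obtain a where "(16 * c + 2) div 3 \<le> w a"
    by blast
  then have "(16 * c + 2) div 3 * 2 ^ card S \<le> 2 ^ (u + 4) * card (?C a)"
    by (simp only: w) (simp add: mult.commute)
  then show thesis
    using few[OF sub _ U' ins'] F by blast
qed

section \<open>A large class after the second weighing\<close>

text \<open>Carries the checks over to outcome classes; in its uses \<open>r\<close> counts the
  choices for the fresh coins left off the pans.\<close>

lemma hits_le_class:
  assumes "finite F" "\<And>P. int (card {X \<in> F. P (balance L R X)}) = r * hits P m q t"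
    "max_hits_ge c m q t" "r \<ge> 0"
  obtains a where "c * 2 ^ m * r \<le> 64 * int (card {X \<in> F. weigh X L R = a})"
proof -
  have hits: "int (card {X \<in> F. weigh X L R = Lt}) = r * hits (\<lambda>b. b < 0) m q t"
    "int (card {X \<in> F. weigh X L R = Eq}) = r * hits (\<lambda>b. b = 0) m q t"
    "int (card {X \<in> F. weigh X L R = Gt}) = r * hits (\<lambda>b. b > 0) m q t"
    using assms(2)[of "\<lambda>b. b < 0"] assms(2)[of "\<lambda>b. b = 0"] assms(2)[of "\<lambda>b. b > 0"]
    by (simp_all only: weigh_iff_balance)
  have *: "c * 2 ^ m * r \<le> 64 * (r * h)" if "c * 2 ^ m \<le> 64 * h" for h
    using mult_right_mono[OF that \<open>r \<ge> 0\<close>] by (simp add: mult_ac)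
  from assms(3) consider "c * 2 ^ m \<le> 64 * hits (\<lambda>b. b = 0) m q t"
    | "c * 2 ^ m \<le> 64 * hits (\<lambda>b. b > 0) m q t" | "c * 2 ^ m \<le> 64 * hits (\<lambda>b. b < 0) m q t"
    unfolding max_hits_ge_def by blast
  then show thesis
  proof cases
    case 1
    then show thesis
      using that[of Eq] * by (simp only: hits)
  next
    case 2
    then show thesis
      using that[of Gt] * by (simp only: hits)
  next
    case 3
    then show thesis
      using that[of Lt] * by (simp only: hits)
  qed
qed

lemma second_weighing_okD:
  assumes "a + b \<le> 3" "c + d \<le> 3" "q \<le> m" "m \<le> 4"
  shows "max_hits_ge 480 m q (heavy_profiles [a, b, 3 - a - b, c, d, 3 - c - d])"
proof -
  have "second_weighing_ok a b c d"
  proof -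
    have "a < 4" "b < 4 - a" "c < 4" "d < 4 - c"
      using assms(1,2) by auto
    then show ?thesis
      using second_weighing_check unfolding list_all_iff set_upt by (meson atLeastLessThan_iff le0)
  qed
  then have "list_all (\<lambda>m. list_all (\<lambda>q. max_hits_ge 480 m q
      (heavy_profiles [a, b, 3 - a - b, c, d, 3 - c - d])) [0..<Suc m]) [0..<5]"
    by (simp only: second_weighing_ok_def some_class_large_def max_hits_ge_def hits_merge)
  moreover have "m < 5" "q < Suc m"
    using assms(3,4) by auto
  ultimately show ?thesis
    unfolding list_all_iff set_upt by (meson atLeastLessThan_iff le0)
qed

lemma second_weighing:
  assumes S: "finite S" and AB: "A \<subseteq> S" "B \<subseteq> S" "A \<inter> B = {}" "card A = 3" "card B = 3"
    and LR: "L \<inter> R = {}"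
    and m: "card ((S - (A \<union> B)) \<inter> (L \<union> R)) \<le> 4"
  obtains a where
    "120 * 2 ^ card S \<le> 2 ^ 10 * card {X \<in> {X \<in> Pow S. balance A B X > 0}. weigh X L R = a}"
proof -
  define W where "W = S - (A \<union> B)"
  define m where "m = card (W \<inter> (L \<union> R))"
  let ?F = "{X \<in> Pow S. balance A B X > 0}"
  have fin: "finite A" "finite B" "finite W"
    using S AB finite_subset by (auto simp: W_def)
  have "card (A \<union> B) = 6"
    using AB fin by (subst card_Un_disjoint) auto
  then have "card S = 6 + card W"
    using S AB unfolding W_def
    by (metis Un_subset_iff card_Diff_subset card_mono finite_subset le_add_diff_inverse)
  have "m \<le> card W"
    unfolding m_def using fin by (simp add: card_mono)
  have "card (W \<inter> R) \<le> m"
    unfolding m_def using fin by (intro card_mono) auto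
  have rest: "card (C \<inter> L) + card (C \<inter> R) \<le> 3 \<and> card (C - L - R) = 3 - card (C \<inter> L) - card (C \<inter> R)"
    if "finite C" "card C = 3" for C
  proof -
    have "card (C \<inter> L) + card (C \<inter> R) = card (C \<inter> (L \<union> R))"
      using that LR by (subst Int_Un_distrib, subst card_Un_disjoint) auto
    moreover have "card (C - L - R) = card C - card (C \<inter> (L \<union> R))"
    proof -
      have "C - L - R = C - C \<inter> (L \<union> R)"
        by auto
      then show ?thesis
        using that by (simp add: card_Diff_subset)
    qed
    moreover have "card (C \<inter> (L \<union> R)) \<le> card C"
      using that by (intro card_mono) auto
    ultimately show ?thesis
      using that by simp
  qed
  have "max_hits_ge 480 m (card (W \<inter> R)) (heavy_profiles (map card
      [A \<inter> L, A \<inter> R, A - L - R, B \<inter> L, B \<inter> R, B - L - R]))"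
    using second_weighing_okD[OF _ _ \<open>card (W \<inter> R) \<le> m\<close>,
        of "card (A \<inter> L)" "card (A \<inter> R)" "card (B \<inter> L)" "card (B \<inter> R)"]
      rest[OF fin(1) AB(4)] rest[OF fin(2) AB(5)] m
    by (simp add: m_def W_def)
  from hits_le_class[OF _ card_second_weighing[OF S AB(1-3) LR, folded W_def, folded m_def] this]
  obtain a where a: "480 * 2 ^ m * 2 ^ (card W - m) \<le> 64 * int (card {X \<in> ?F. weigh X L R = a})"
    using S by auto
  \<comment> \<open>The six old coins give the factor 64, so the share obtained is
    \<open>480 / 2 ^ 12 = 120 / 2 ^ 10\<close>.\<close>
  have "(2 :: int) ^ card S = 64 * (2 ^ m * 2 ^ (card W - m))"
    using \<open>m \<le> card W\<close> unfolding \<open>card S = 6 + card W\<close> by (simp add: power_add[of _ 6] flip: power_add[of _ m])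
  then have "int (120 * 2 ^ card S) \<le> int (2 ^ 10 * card {X \<in> ?F. weigh X L R = a})"
    using a by simp
  then have "120 * 2 ^ card S \<le> 2 ^ 10 * card {X \<in> ?F. weigh X L R = a}"
    by (simp only: of_nat_le_iff)
  then show thesis
    by (rule that)
qed

section \<open>The first weighing\<close>

text \<open>By symmetry this is half of the \<open>2 ^ 6 - (6 choose 3) = 44\<close> unbalanced
  cases.\<close>

lemma three_vs_three: "hits (\<lambda>b. b > 0) 6 3 [(1, 0)] = 22"
  by code_simp

lemma card_first_weighing:
  assumes "finite S" "L \<subseteq> S" "R \<subseteq> S" "L \<inter> R = {}"
  shows "int (card {X \<in> Pow S. P (balance L R X)}) =
    2 ^ (card S - card (L \<union> R)) * hits P (card (L \<union> R)) (card R) [(1, 0)]"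
proof -
  have "S \<inter> (L \<union> R) = L \<union> R" "S \<inter> R = R"
    using assms by auto
  then show ?thesis
    using sum_Pow_balance_shifted[OF assms(1,4), of P 0] card_eq_sum_if[of "Pow S"] assms(1)
    by (simp add: hits_def)
qed

lemma first_weighing:
  assumes S: "finite S" and LR: "L \<subseteq> S" "R \<subseteq> S" "L \<inter> R = {}"
    and "\<not> (card L = 3 \<and> card R = 3)"
    and sub: "\<And>a. distinguishable S {X \<in> Pow S. weigh X L R = a} k"
  shows "23 * 2 ^ card S \<le> 64 * (3 :: nat) ^ k"
proof -
  let ?C = "\<lambda>a. {X \<in> Pow S. weigh X L R = a}" and ?m = "card (L \<union> R)"
  have class_le: "card (?C a) \<le> 3 ^ k" for a
    using distinguishable_card_le[OF sub] S by simp
  have fin: "finite L" "finite R"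
    using LR(1,2) S by (auto intro: finite_subset)
  then have m: "?m = card L + card R"
    using LR by (intro card_Un_disjoint)
  have "?m \<le> card S"
    using S LR by (intro card_mono) auto
  show ?thesis
  proof (cases "?m < 7")
    case True
    then have "?m \<in> set [0..<7]" "card R \<in> set [0..<Suc ?m]" "(?m, card R) \<noteq> (6, 3)"
      using assms(5) m by (simp_all only: set_upt atLeastLessThan_iff) auto
    then have "max_hits_ge 23 ?m (card R) [(1, 0)]"
      using first_weighing_check by blast
    from hits_le_class[OF _ card_first_weighing[OF S LR] this]
    obtain a where "23 * 2 ^ ?m * 2 ^ (card S - ?m) \<le> 64 * int (card (?C a))"
      using S by auto
    moreover have "(2 :: int) ^ ?m * 2 ^ (card S - ?m) = 2 ^ card S"
      using \<open>?m \<le> card S\<close> by (simp flip: power_add)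
    ultimately have "int (23 * 2 ^ card S) \<le> int (64 * card (?C a))"
      by simp
    then have "23 * 2 ^ card S \<le> 64 * card (?C a)"
      by (simp only: of_nat_le_iff)
    then show ?thesis
      using class_le[of a] by linarith
  next
    case False
    then obtain W where W: "W \<subseteq> L \<union> R" "card W = 7"
      by (metis not_less obtain_subset_with_card_n)
    then have "W \<subseteq> S"
      using LR by auto
    have choose: "7 choose 3 = (35 :: nat)"
      by (simp add: numeral_eq_Suc)
    from card_balanced_le[OF insensitive_Pow[OF \<open>W \<subseteq> S\<close>] subset_refl S \<open>W \<subseteq> S\<close> W(1) LR(3)]
    have "128 * card (?C Eq) \<le> 35 * card (Pow S)"
      by (simp add: W(2) weigh_iff_balance choose)
    \<comment> \<open>One of the unbalanced classes has share at least \<open>93 / 256\<close>, just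
      above \<open>23 / 64 = 92 / 256\<close>.\<close>
    then have "93 * card (Pow S) \<le> 256 * 3 ^ k"
      using card_weigh[of "Pow S" L R] S class_le[of Lt] class_le[of Gt] by simp
    then show ?thesis
      using S by (simp add: card_Pow)
  qed
qed

section \<open>Four weighings combined\<close>

text \<open>The last \<open>j\<close> weighings separate at most \<open>3 ^ j\<close> subsets. So a
  class of share \<open>1707 / 2 ^ 17\<close> after four weighings is enough, or an earlier class
  whose share exceeds this after division by 3 for each weighing still missing.\<close>

lemma power_le_of_distinguishable:
  assumes S: "finite S" and j: "distinguishable S (Pow S) (j + 4)"
  shows "1707 * 2 ^ card S \<le> 2 ^ 17 * (3 :: nat) ^ j"
proof -
  have "distinguishable S (Pow S) (Suc (j + 3))"
    using j by (simp add: eval_nat_numeral)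
  then obtain A B where AB: "A \<subseteq> S" "B \<subseteq> S" "A \<inter> B = {}"
    and sub: "\<And>a. distinguishable S {X \<in> Pow S. weigh X A B = a} (j + 3)"
    by (rule distinguishable_Suc) blast
  show ?thesis
  proof (cases "card A = 3 \<and> card B = 3")
    case False
    \<comment> \<open>Three weighings are missing, and \<open>23 / 64 / 27\<close> is about 0.01331,
      against about 0.01302 for \<open>1707 / 2 ^ 17\<close>.\<close>
    from first_weighing[OF S AB False sub] show ?thesis
      by (simp add: power_add)
  next
    case True
    let ?F = "{X \<in> Pow S. balance A B X > 0}" and ?U = "A \<union> B"
    have fin: "finite A" "finite B"
      using S AB(1,2) by (auto intro: finite_subset)
    have U: "?U \<subseteq> S" "card ?U = 6"
      using True AB fin by (auto simp: card_Un_disjoint)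
    then have "6 \<le> card S"
      using S card_mono by metis
    have "2 ^ card S = 2 ^ 6 * (2 :: int) ^ (card S - 6)"
      using \<open>6 \<le> card S\<close> by (metis le_add_diff_inverse power_add)
    then have "int (64 * card ?F) = int (22 * 2 ^ card S)"
      using card_first_weighing[OF S AB, of "\<lambda>b. b > 0"] U True three_vs_three by simp
    then have card_F: "64 * card ?F = 22 * 2 ^ card S"
      by (simp only: of_nat_eq_iff)
    have F: "?F \<subseteq> Pow S" "insensitive (S - ?U) ?F"
      using insensitive_balance[OF insensitive_Pow[of S S]] by auto
    have "distinguishable S ?F (Suc (j + 2))"
      using sub[of Gt] by (simp add: weigh_iff_balance eval_nat_numeral)
    then show ?thesis
    proof (rule distinguishable_few_fresh_coins[OF S _ F])
      \<comment> \<open>Here the share is \<open>22 / 64 * 11 / 32\<close>, and division by 9 leaves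
        about 0.01313. The later cases of many fresh coins leave about 0.01343.\<close>
      assume "11 * card ?F \<le> 32 * 3 ^ (j + 2)"
      then show ?thesis
        using card_F by (simp add: power_add)
    next
      fix L R
      assume LR: "L \<subseteq> S" "R \<subseteq> S" "L \<inter> R = {}" and fresh: "card ((S - ?U) \<inter> (L \<union> R)) \<le> 4"
        and sub2: "\<And>a. distinguishable S {X \<in> ?F. weigh X L R = a} (j + 2)"
      obtain a where a: "120 * 2 ^ card S \<le> 2 ^ 10 * card {X \<in> ?F. weigh X L R = a}"
        using second_weighing[OF S AB _ _ LR(3) fresh] True by blast
      let ?G = "{X \<in> ?F. weigh X L R = a}" and ?V = "?U \<union> L \<union> R"
      have G: "?G \<subseteq> Pow S"
        by auto
      have V: "?V \<subseteq> S" "card ?V \<le> 10"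
        using card_Un_fresh_le[OF S U(1) LR(1,2) _ fresh, of 6] U LR by auto
      have ins: "insensitive (S - ?V) ?G"
        using insensitive_weigh[OF F(2)] by (simp add: Diff_eq inf_assoc)
      have "distinguishable S ?G (Suc (j + 1))"
        using sub2[of a] by (simp add: eval_nat_numeral)
      then show ?thesis
      proof (rule distinguishable_largest_class[OF S _ G V ins a])
        assume "11 * card ?G \<le> 32 * 3 ^ (j + 1)"
        then show ?thesis
          using a by simp
      next
        fix H V'
        assume H: "distinguishable S H (j + 1)" "H \<subseteq> Pow S" "V' \<subseteq> S" "card V' \<le> 10 + 4"
          "insensitive (S - V') H" "(16 * 120 + 2) div 3 * 2 ^ card S \<le> 2 ^ (10 + 4) * card H"
        have "distinguishable S H (Suc j)"
          using H(1) by simp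
        then show ?thesis
        proof (rule distinguishable_largest_class[OF S _ H(2-6)])
          assume "11 * card H \<le> 32 * 3 ^ j"
          then show ?thesis
            using H(6) by simp
        next
          fix K V''
          assume K: "distinguishable S K j" "K \<subseteq> Pow S"
            "(16 * ((16 * 120 + 2) div 3) + 2) div 3 * 2 ^ card S \<le> 2 ^ (10 + 4 + 4) * card K"
          have "card K \<le> 3 ^ j"
            using K(1,2) S by (meson distinguishable_card_le finite_Pow_iff finite_subset)
          then show ?thesis
            using K(3) by simp
        qed
      qed
    qed
  qed
qed

section \<open>The bound for \<open>g\<close>\<close>

lemma power_le_three_power_g:
  assumes "n \<ge> 1"
  shows "138267 * 2 ^ n \<le> 2 ^ 17 * (3 :: nat) ^ g n"
proof -
  have g: "distinguishable {1..n} (Pow {1..n}) (g n)"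
    using weighings_suffice_g unfolding weighings_suffice_def finds_all_fakes_def distinguishable_def
    by blast
  show ?thesis
  proof (cases "g n \<ge> 4")
    case True
    then obtain j where j: "g n = j + 4"
      by (metis add.commute le_Suc_ex)
    with power_le_of_distinguishable[of "{1..n}" j] g show ?thesis
      by (simp add: power_add)
  next
    case False
    \<comment> \<open>With fewer than four weighings the counting bound gives
      \<open>2 ^ n \<le> 27 < 2 ^ 5\<close>, which leaves finitely many pairs to check.\<close>
    have "(2 :: nat) ^ n \<le> 3 ^ g n"
      using distinguishable_card_le[OF g] by (simp add: card_Pow)
    moreover from this have "(2 :: nat) ^ n < 2 ^ 5"
      using False power_increasing[of "g n" 3 "3 :: nat"] by simp
    then have "n < 5"
      using power_less_imp_less_exp[of 2 n 5] by simp
    then have "n \<in> {1, 2, 3, 4}" "g n \<in> {0, 1, 2, 3}"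
      using False \<open>n \<ge> 1\<close> by auto
    moreover have "138267 * 2 ^ m \<le> 2 ^ 17 * (3 :: nat) ^ k"
      if "m \<in> {1, 2, 3, 4}" "k \<in> {0, 1, 2, 3}" "2 ^ m \<le> (3 :: nat) ^ k" for m k :: nat
      using that by auto
    ultimately show ?thesis
      by blast
  qed
qed

theorem proposition1:
  fixes n :: nat
  assumes "n \<ge> 1"
  shows "int (g n) \<ge>
    \<lceil>log 3 ((2::real) powi int n + 2 powi (int n - 5) + 2 powi (int n - 6) + 2 powi (int n - 7)
       + 2 powi (int n - 13) + 2 powi (int n - 14) + 2 powi (int n - 16) + 2 powi (int n - 17))\<rceil>"
proof -
  let ?s = "(2::real) powi int n + 2 powi (int n - 5) + 2 powi (int n - 6) + 2 powi (int n - 7)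
       + 2 powi (int n - 13) + 2 powi (int n - 14) + 2 powi (int n - 16) + 2 powi (int n - 17)"
  \<comment> \<open>Over the denominator \<open>2 ^ 17\<close> the numerator is
    \<open>131072 + 4096 + 2048 + 1024 + 16 + 8 + 2 + 1\<close>.\<close>
  have s: "?s = 138267 / 2 ^ 17 * 2 ^ n"
    by (simp add: power_int_diff field_simps)
  have "real (138267 * 2 ^ n) \<le> real (2 ^ 17 * 3 ^ g n)"
    using power_le_three_power_g[OF assms] by (simp only: of_nat_le_iff)
  then have "?s \<le> 3 ^ g n"
    unfolding s by simp
  moreover have "?s > 0"
    unfolding s by simp
  ultimately have "log 3 ?s \<le> real (g n)"
    by (simp add: log_le_iff powr_realpow)
  then show ?thesis
    by (simp add: ceiling_le_iff)
qed

end
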